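(* Let $m:SE(3)\to\mathrm{Aut}(\mathbb R^6)$ be the matrix group representation $$m(\mathbf x,R)=\begin{pmatrix}R&\sigma_{\mathbf x}R\\0&R\end{pmatrix},$$ for which, along sub-Riemannian geodesics $\gamma$, $\ d\boldsymbol\lambda|_\gamma=\boldsymbol\lambda|_\gamma\,m(\gamma^{-1})\,dm(\gamma)$. Then along the sub-Riemannian geodesics $\gamma$ in $(SE(3),\Delta,\mathcal G_1)$ with $\gamma(0)=e$, parametrized by spatial arclength $s$ (up to the first cusp), the following relation holds: $$\boldsymbol\lambda(s)\,m(\gamma(s))^{-1}=\boldsymbol\lambda(0)\,m(\gamma(0))^{-1}=\boldsymbol\lambda(0).$$
   Context: $SE(3)=\mathbb R^3\rtimes SO(3)$ with product $(\mathbf x_1,R_1)(\mathbf x_2,R_2)=(\mathbf x_1+R_1\mathbf x_2,R_1R_2)$, unit $e=(\mathbf 0,I)$. For $\mathbf x\in\mathbb R^3$, $\sigma_{\mathbf x}\in so(3)$ is defined by $\sigma_{\mathbf x}\mathbf y=\mathbf x\times\mathbf y$. Left-invariant frame: $\mathcal A_i|_{(\mathbf x,R)}=(R\mathbf e_i,0)$, $\mathcal A_{3+i}|_{(\mathbf x,R)}=(0,R\sigma_{\mathbf e_i})$, $i=1,2,3$, with dual coframe $\omega^i$. $\Delta=\mathrm{span}\{\mathcal A_3,\mathcal A_4,\mathcal A_5\}$ and $\mathcal G_1=\sum_{i=3}^5\omega^i\otimes\omega^i$. Sub-Riemannian geodesics of $(SE(3),\Delta,\mathcal G_1)$ in sub-Riemannian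 arclength $t$ are projections of solutions of the Hamiltonian system ($H=\frac12(\lambda_3^2+\lambda_4^2+\lambda_5^2)=\frac12$): $\dot\gamma=\lambda_3\mathcal A_3+\lambda_4\mathcal A_4+\lambda_5\mathcal A_5$; $\dot\lambda_1=-\lambda_3\lambda_5$, $\dot\lambda_2=\lambda_3\lambda_4$, $\dot\lambda_3=\lambda_1\lambda_5-\lambda_2\lambda_4$, $\dot\lambda_4=\lambda_2\lambda_3-\lambda_5\lambda_6$, $\dot\lambda_5=\lambda_4\lambda_6-\lambda_1\lambda_3$, $\dot\lambda_6=0$. The momentum covector $\lambda=\sum_{i=1}^6\lambda_i\omega^i|_\gamma$ is represented by the row vector $\boldsymbol\lambda=(\lambda_1,\dots,\lambda_6)$. Spatial arclength $s$ is defined by $ds/dt=\lambda_3>0$ and is valid for $0\le s\le s_{max}$, where $s_{max}$ is the first positive value at which $\lambda_3$ vanishes (first cusp). *)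

theory Defs
  imports "HOL-Analysis.Analysis" "HOL-Algebra.Group"
begin

(* Matrices are real^3^3 and vectors columns; v v* A is the row vector v times A.
   Six-dimensional objects are indexed by the sum type 3 + 3:
   index i of {1,..,6} is Inl i for i <= 3 and Inr (i - 3) for i >= 4. *)

definition hat :: "real^3 \<Rightarrow> real^3^3" where
  "hat x = matrix (\<lambda>y. cross3 x y)"

definition SE3 :: "((real^3) \<times> (real^3^3)) monoid" where
  "SE3 = \<lparr>carrier = {(x, R). rotation_matrix R},
          mult = (\<lambda>(x1, R1) (x2, R2). (x1 + R1 *v x2, R1 ** R2)),
          one = (0, mat 1)\<rparr>"

(* Aut(R^6), as invertible matrices. *)
definition Aut_R6 :: "(real^(3+3)^(3+3)) monoid" where
  "Aut_R6 = \<lparr>carrier = {A. invertible A}, mult = (**), one = mat 1\<rparr>"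

definition block_matrix ::
  "real^3^3 \<Rightarrow> real^3^3 \<Rightarrow> real^3^3 \<Rightarrow> real^3^3 \<Rightarrow> real^(3+3)^(3+3)" where
  "block_matrix A B C D = (\<chi> i j.
     case i of
       Inl a \<Rightarrow> (case j of Inl b \<Rightarrow> A $ a $ b | Inr b \<Rightarrow> B $ a $ b)
     | Inr a \<Rightarrow> (case j of Inl b \<Rightarrow> C $ a $ b | Inr b \<Rightarrow> D $ a $ b))"

definition se3_rep :: "(real^3) \<times> (real^3^3) \<Rightarrow> real^(3+3)^(3+3)" where
  "se3_rep = (\<lambda>(x, R). block_matrix R (hat x ** R) 0 R)"

(* Tangent vectors of SE(3) are represented in the ambient vector space. *)
definition left_frame :: "3 + 3 \<Rightarrow> (real^3) \<times> (real^3^3) \<Rightarrow> (real^3) \<times> (real^3^3)" where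
  "left_frame i = (\<lambda>(x, R).
     case i of Inl k \<Rightarrow> (R *v axis k 1, 0) | Inr k \<Rightarrow> (0, R ** hat (axis k 1)))"

(* Solutions, on an interval I containing 0, of the Hamiltonian system on the level H = 1/2;
   sub-Riemannian geodesics are the components \<gamma> of such pairs (\<gamma>, l), and l holds the
   components of the momentum covector in the left-invariant dual coframe.
   In the numeral type 3 the numeral 3 is the third index, distinct from 1 and 2. *)
definition sr_extremal ::
  "real set \<Rightarrow> (real \<Rightarrow> (real^3) \<times> (real^3^3)) \<Rightarrow> (real \<Rightarrow> real^(3+3)) \<Rightarrow> bool" where
  "sr_extremal I \<gamma> l \<longleftrightarrow>
     is_interval I \<and> 0 \<in> I \<and>
     (\<forall>t\<in>I.
        let l1 = l t $ Inl 1; l2 = l t $ Inl 2; l3 = l t $ Inl 3;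
            l4 = l t $ Inr 1; l5 = l t $ Inr 2; l6 = l t $ Inr 3
        in \<gamma> t \<in> carrier SE3 \<and>
           (l3\<^sup>2 + l4\<^sup>2 + l5\<^sup>2) / 2 = 1 / 2 \<and>
           (\<gamma> has_vector_derivative
              (l3 *\<^sub>R left_frame (Inl 3) (\<gamma> t) + l4 *\<^sub>R left_frame (Inr 1) (\<gamma> t)
                + l5 *\<^sub>R left_frame (Inr 2) (\<gamma> t))) (at t within I) \<and>
           ((\<lambda>u. l u $ Inl 1) has_real_derivative - l3 * l5) (at t within I) \<and>
           ((\<lambda>u. l u $ Inl 2) has_real_derivative l3 * l4) (at t within I) \<and>
           ((\<lambda>u. l u $ Inl 3) has_real_derivative l1 * l5 - l2 * l4) (at t within I) \<and>
           ((\<lambda>u. l u $ Inr 1) has_real_derivative l2 * l3 - l5 * l6) (at t within I) \<and>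
           ((\<lambda>u. l u $ Inr 2) has_real_derivative l4 * l6 - l1 * l3) (at t within I) \<and>
           ((\<lambda>u. l u $ Inr 3) has_real_derivative 0) (at t within I))"

definition spatial_arclength :: "(real \<Rightarrow> real^(3+3)) \<Rightarrow> real \<Rightarrow> real" where
  "spatial_arclength l t = integral {0..t} (\<lambda>u. l u $ Inl 3)"

(* ds/dt = l $ Inl 3 has to be positive strictly between s = 0 and the first cusp. When it is
   positive right after time 0, this set consists of the times up to and including the first
   cusp (the first positive zero of l $ Inl 3), or of all nonnegative times in I if there is
   none; otherwise it is {0}. The spatial arclength is strictly increasing on it, and its
   image is [0, smax] when the cusp occurs in I. *)
definition times_to_first_cusp :: "real set \<Rightarrow> (real \<Rightarrow> real^(3+3)) \<Rightarrow> real set" where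
  "times_to_first_cusp I l = {t \<in> I. 0 \<le> t \<and> (\<forall>u. 0 < u \<and> u < t \<longrightarrow> 0 < l u $ Inl 3)}"

definition spatial_range :: "real set \<Rightarrow> (real \<Rightarrow> real^(3+3)) \<Rightarrow> real set" where
  "spatial_range I l = spatial_arclength l ` times_to_first_cusp I l"

(* A function f of t, reparametrized by spatial arclength. *)
definition by_spatial_arclength ::
  "real set \<Rightarrow> (real \<Rightarrow> real^(3+3)) \<Rightarrow> (real \<Rightarrow> 'a) \<Rightarrow> real \<Rightarrow> 'a" where
  "by_spatial_arclength I l f s =
     f (the_inv_into (times_to_first_cusp I l) (spatial_arclength l) s)"

end

theory Submission
  imports Defs
begin

text \<open>
  On SE(3) the derivative of the representation along a curve with body velocity (v, w) is
  \<open>m \<mu>(v, w)\<close>, where \<open>\<mu>(v, w)\<close> has diagonal blocks \<open>hat w\<close> and upper right block \<open>hat v\<close>.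
  The vertical part of the Hamiltonian system is exactly \<open>\<lambda>' = \<lambda> \<mu>(v, w)\<close>, hence
  \<open>\<lambda>' = \<lambda> m\<^sup>-\<^sup>1 m'\<close>, and the product rule shows that \<open>\<lambda> m\<^sup>-\<^sup>1\<close> has derivative zero. The first cusp
  is the end of the interval on which the spatial arclength is strictly increasing, so that the
  reparametrization only evaluates the curve at times of the interval.
\<close>

section \<open>Block matrices and the representation\<close>

text \<open>The row-vector counterpart of \<open>block_matrix\<close>: it joins translational and
  rotational momentum, so that the row action can be computed block by block.\<close>

definition block_vector :: "real^3 \<Rightarrow> real^3 \<Rightarrow> real^(3+3)" where
  "block_vector p q = (\<chi> i. case i of Inl a \<Rightarrow> p $ a | Inr a \<Rightarrow> q $ a)"

lemma sum_UNIV_sum: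
  fixes f :: "'a::finite + 'b::finite \<Rightarrow> 'c::comm_monoid_add"
  shows "sum f UNIV = (\<Sum>a\<in>UNIV. f (Inl a)) + (\<Sum>b\<in>UNIV. f (Inr b))"
  unfolding UNIV_Plus_UNIV[symmetric] by (subst sum.Plus) auto

lemma block_matrix_mult:
  "block_matrix A B C D ** block_matrix E F G H =
     block_matrix (A ** E + B ** G) (A ** F + B ** H) (C ** E + D ** G) (C ** F + D ** H)"
  by (simp add: block_matrix_def matrix_matrix_mult_def vec_eq_iff sum_UNIV_sum split: sum.splits)

lemma block_vector_matrix_mult:
  "block_vector p q v* block_matrix A B C D = block_vector (p v* A + q v* C) (p v* B + q v* D)"
  by (simp add: block_matrix_def block_vector_def vector_matrix_mult_def vec_eq_iff sum_UNIV_sum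
      split: sum.splits)

lemma block_matrix_one: "block_matrix (mat 1) 0 0 (mat 1) = mat 1"
  by (simp add: block_matrix_def mat_def vec_eq_iff split: sum.splits)

text \<open>Linearity is taken jointly on the tuple of blocks, so that a derivative of the tuple
  passes directly through \<open>block_matrix\<close>.\<close>

lemma linear_block_matrix: "linear (\<lambda>(A, B, C, D). block_matrix A B C D)"
  by (rule linearI) (auto simp: block_matrix_def vec_eq_iff split: sum.splits)

lemma linear_block_vector: "linear (\<lambda>(p, q). block_vector p q)"
  by (rule linearI) (auto simp: block_vector_def vec_eq_iff split: sum.splits)

lemma matrix_add_rdistrib:
  fixes A B :: "'a::semiring_1^'n^'m"
  shows "(A + B) ** C = A ** C + B ** C"
  by (simp add: vec_eq_iff matrix_matrix_mult_def distrib_right sum.distrib)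

section \<open>The hat map and its equivariance under rotations\<close>

lemma hat_mult_vector: "hat x *v y = cross3 x y"
  using bilinear_cross unfolding hat_def bilinear_def by (simp add: matrix_vector_mul)

text \<open>The matrix \<open>hat x\<close> is skew, so acting on a row instead of a column reverses
  the sign of the cross product, that is, swaps its factors.\<close>

lemma vector_mult_hat: "p v* hat x = cross3 p x"
  by (simp add: vec_eq_iff vector_matrix_mult_def hat_def matrix_def cross3_def forall_3 sum_3
      axis_def)

lemma linear_hat: "linear hat"
  by (rule linearI)
    (simp_all add: matrix_eq hat_mult_vector matrix_vector_mult_add_rdistrib cross_add_left
      cross_mult_left scaleR_matrix_vector_assoc[symmetric])

text \<open>Rotations preserve the cross product: (R x) \<times> (R y) = R (x \<times> y). This is
  the conjugation formula for \<open>hat\<close> with the inverse of R cleared.\<close>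

lemma hat_rotation:
  assumes "rotation_matrix R"
  shows "hat (R *v x) ** R = R ** hat x"
  using assms
  by (simp add: matrix_eq matrix_vector_mul_assoc[symmetric] hat_mult_vector cross_rotation_matrix)

section \<open>The groups and the homomorphism\<close>

lemma rotation_matrix_mult:
  fixes A B :: "real^'n^'n"
  shows "rotation_matrix A \<Longrightarrow> rotation_matrix B \<Longrightarrow> rotation_matrix (A ** B)"
  by (simp add: rotation_matrix_def orthogonal_matrix_mul det_mul)

lemma rotation_matrix_transpose: "rotation_matrix A \<Longrightarrow> rotation_matrix (transpose A)"
  by (simp add: rotation_matrix_def orthogonal_matrix_transpose)

lemma SE3_left_inverse:
  assumes "rotation_matrix R"
  shows "(- (transpose R *v x), transpose R) \<otimes>\<^bsub>SE3\<^esub> (x, R) = \<one>\<^bsub>SE3\<^esub>"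
  using assms by (simp add: SE3_def rotation_matrix_def orthogonal_matrix_def)

lemma group_SE3: "group SE3"
proof (rule groupI)
  fix g assume "g \<in> carrier SE3"
  then obtain x R where g: "g = (x, R)" and R: "rotation_matrix R"
    by (auto simp: SE3_def)
  have "(- (transpose R *v x), transpose R) \<in> carrier SE3"
    using rotation_matrix_transpose[OF R] by (simp add: SE3_def)
  with SE3_left_inverse[OF R] show "\<exists>h\<in>carrier SE3. h \<otimes>\<^bsub>SE3\<^esub> g = \<one>\<^bsub>SE3\<^esub>"
    unfolding g by blast
qed (auto simp: SE3_def rotation_matrix_mult matrix_mul_assoc matrix_vector_mul_assoc
    matrix_vector_right_distrib add.assoc rotation_matrix_def[of "mat 1"] orthogonal_matrix_id)

lemma inv_SE3:
  assumes "(x, R) \<in> carrier SE3"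
  shows "inv\<^bsub>SE3\<^esub> (x, R) = (- (transpose R *v x), transpose R)"
proof (rule group.inv_equality[OF group_SE3 _ assms])
  have R: "rotation_matrix R" using assms by (simp add: SE3_def)
  then show "(- (transpose R *v x), transpose R) \<otimes>\<^bsub>SE3\<^esub> (x, R) = \<one>\<^bsub>SE3\<^esub>"
    by (rule SE3_left_inverse)
  show "(- (transpose R *v x), transpose R) \<in> carrier SE3"
    using rotation_matrix_transpose[OF R] by (simp add: SE3_def)
qed

lemma group_Aut_R6: "group Aut_R6"
proof (rule groupI)
  fix A assume "A \<in> carrier Aut_R6"
  then show "\<exists>B\<in>carrier Aut_R6. B \<otimes>\<^bsub>Aut_R6\<^esub> A = \<one>\<^bsub>Aut_R6\<^esub>"
    by (auto simp: Aut_R6_def invertible_def)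
qed (auto simp: Aut_R6_def invertible_mult matrix_mul_assoc invertible_def[of "mat 1"])

section \<open>Multiplicativity and inverses of the representation\<close>

lemma se3_rep_one: "se3_rep \<one>\<^bsub>SE3\<^esub> = mat 1"
  by (simp add: se3_rep_def SE3_def block_matrix_one linear_0[OF linear_hat])

text \<open>Only the upper right block needs an argument. In the matrix product it is R hat(y) S +
  hat(x) R S, and \<open>hat_rotation\<close> turns the first summand into hat(R y) R S.\<close>

lemma se3_rep_mult:
  assumes "g \<in> carrier SE3"
  shows "se3_rep (g \<otimes>\<^bsub>SE3\<^esub> h) = se3_rep g ** se3_rep h"
proof -
  obtain x R y S where g: "g = (x, R)" and h: "h = (y, S)" by fastforce
  with assms have "rotation_matrix R" by (simp add: SE3_def)
  then have "hat (R *v y) ** (R ** S) = R ** (hat y ** S)"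
    by (simp add: matrix_mul_assoc hat_rotation)
  then show ?thesis
    by (simp add: g h se3_rep_def SE3_def block_matrix_mult linear_add[OF linear_hat]
        matrix_add_rdistrib matrix_mul_assoc add.commute)
qed

lemma se3_rep_inv:
  assumes "g \<in> carrier SE3"
  shows "se3_rep (inv\<^bsub>SE3\<^esub> g) ** se3_rep g = mat 1"
    and "se3_rep g ** se3_rep (inv\<^bsub>SE3\<^esub> g) = mat 1"
proof -
  interpret group SE3 by (rule group_SE3)
  show "se3_rep (inv\<^bsub>SE3\<^esub> g) ** se3_rep g = mat 1"
    and "se3_rep g ** se3_rep (inv\<^bsub>SE3\<^esub> g) = mat 1"
    using se3_rep_mult[OF inv_closed[OF assms], of g] se3_rep_mult[OF assms, of "inv\<^bsub>SE3\<^esub> g"]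
    by (simp_all only: l_inv[OF assms] r_inv[OF assms] se3_rep_one)
qed

lemma group_hom_se3_rep: "group_hom SE3 Aut_R6 se3_rep"
proof -
  have "invertible (se3_rep g)" if "g \<in> carrier SE3" for g
    using se3_rep_inv[OF that] by (auto simp: invertible_def)
  then have "se3_rep \<in> hom SE3 Aut_R6"
    by (auto simp: hom_def Aut_R6_def se3_rep_mult)
  then show ?thesis
    by (simp add: group_hom_def group_hom_axioms_def group_SE3 group_Aut_R6)
qed

lemma matrix_inv_se3_rep:
  assumes "g \<in> carrier SE3"
  shows "matrix_inv (se3_rep g) = se3_rep (inv\<^bsub>SE3\<^esub> g)"
proof -
  \<comment> \<open>\<open>matrix_inv\<close> is a choice operator. Since a two-sided inverse
    exists, the chosen matrix is one, and uniqueness of inverses then identifies it.\<close>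
  have "se3_rep g ** matrix_inv (se3_rep g) = mat 1 \<and> matrix_inv (se3_rep g) ** se3_rep g = mat 1"
    unfolding matrix_inv_def by (rule someI) (use se3_rep_inv[OF assms] in blast)
  then have "se3_rep (inv\<^bsub>SE3\<^esub> g) ** (se3_rep g ** matrix_inv (se3_rep g)) =
      se3_rep (inv\<^bsub>SE3\<^esub> g)"
    by (simp only: matrix_mul_rid)
  then show ?thesis
    by (simp only: matrix_mul_assoc se3_rep_inv[OF assms] matrix_mul_lid)
qed

section \<open>Differentiation\<close>

lemma bounded_bilinear_matrix_mult:
  "bounded_bilinear ((**) :: real^'n^'m \<Rightarrow> real^'k^'n \<Rightarrow> real^'k^'m)"
  unfolding bilinear_conv_bounded_bilinear[symmetric] bilinear_def
  by (auto intro!: linearI simp: matrix_add_ldistrib matrix_add_rdistrib matrix_scalar_ac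
      scalar_matrix_assoc)

lemma bounded_bilinear_matrix_vector_mult:
  "bounded_bilinear ((*v) :: real^'n^'m \<Rightarrow> real^'n \<Rightarrow> real^'m)"
  unfolding bilinear_conv_bounded_bilinear[symmetric] bilinear_def
  by (auto intro!: linearI simp: matrix_vector_mult_add_rdistrib matrix_vector_right_distrib
      scaleR_matrix_vector_assoc matrix_vector_mult_scaleR)

lemma bounded_bilinear_vector_matrix_mult:
  "bounded_bilinear ((v*) :: real^'m \<Rightarrow> real^'n^'m \<Rightarrow> real^'n)"
  unfolding bilinear_conv_bounded_bilinear[symmetric] bilinear_def
  by (auto intro!: linearI simp: vec_eq_iff vector_matrix_mult_def algebra_simps sum.distrib
      sum_distrib_left)

lemmas has_vector_derivative_linear =
  bounded_linear.has_vector_derivative[OF linear_conv_bounded_linear[THEN iffD1]]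

lemma se3_rep_has_vector_derivative:
  assumes x: "(x has_vector_derivative x') (at t within S)"
    and R: "(R has_vector_derivative R') (at t within S)"
  shows "((\<lambda>u. se3_rep (x u, R u)) has_vector_derivative
    block_matrix R' (hat (x t) ** R' + hat x' ** R t) 0 R') (at t within S)"
proof -
  have "((\<lambda>u. hat (x u) ** R u) has_vector_derivative hat (x t) ** R' + hat x' ** R t)
      (at t within S)"
    by (rule bounded_bilinear.has_vector_derivative[OF bounded_bilinear_matrix_mult
          has_vector_derivative_linear[OF linear_hat x] R])
  \<comment> \<open>The four blocks are differentiated as one tuple, to which the linear map
    \<open>block_matrix\<close> is then applied.\<close>
  then have "((\<lambda>u. (R u, hat (x u) ** R u, 0 :: real^3^3, R u)) has_vector_derivative
      (R', hat (x t) ** R' + hat x' ** R t, 0, R')) (at t within S)"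
    by (intro has_vector_derivative_Pair R has_vector_derivative_const)
  from has_vector_derivative_linear[OF linear_block_matrix this] show ?thesis
    by (simp add: se3_rep_def)
qed

text \<open>Differentiating N M = 1 gives N' = - N M' N. The product rule for l N then yields l N M'
  N + l N' = 0, and a curve with zero derivative on an interval is constant.\<close>

lemma transport_constant:
  fixes l :: "real \<Rightarrow> real^'n" and M N :: "real \<Rightarrow> real^'n^'n"
  assumes "is_interval S"
    and NM: "\<And>t. t \<in> S \<Longrightarrow> N t ** M t = mat 1"
    and MN: "\<And>t. t \<in> S \<Longrightarrow> M t ** N t = mat 1"
    and M: "\<And>t. t \<in> S \<Longrightarrow> (M has_vector_derivative M' t) (at t within S)"
    and N: "\<And>t. t \<in> S \<Longrightarrow> (N has_vector_derivative N' t) (at t within S)"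
    and l: "\<And>t. t \<in> S \<Longrightarrow> (l has_vector_derivative l t v* (N t ** M' t)) (at t within S)"
    and "a \<in> S" "b \<in> S"
  shows "l a v* N a = l b v* N b"
proof (cases "a = b")
  case False
  have conv: "convex S" using \<open>is_interval S\<close> by (rule is_interval_convex)
  have "((\<lambda>u. l u v* N u) has_derivative (\<lambda>h. 0)) (at t within S)" if t: "t \<in> S" for t
  proof -
    \<comment> \<open>A derivative within \<open>S\<close> is unique only at a limit point of
      \<open>S\<close>; a connected set containing the distinct points \<open>a\<close> and
      \<open>b\<close> has no isolated points.\<close>
    have "t islimpt S"
      using connected_imp_perfect[OF convex_connected[OF conv] t] False \<open>a \<in> S\<close> \<open>b \<in> S\<close> by blast
    then have nb: "at t within S \<noteq> bot"
      by (simp add: trivial_limit_within)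
    have "((\<lambda>u. N u ** M u) has_vector_derivative N t ** M' t + N' t ** M t) (at t within S)"
      by (rule bounded_bilinear.has_vector_derivative[OF bounded_bilinear_matrix_mult
            N[OF t] M[OF t]])
    moreover have "((\<lambda>u. N u ** M u) has_vector_derivative 0) (at t within S)"
      by (rule has_vector_derivative_transform[OF t NM has_vector_derivative_const])
    ultimately have "N t ** M' t + N' t ** M t = 0"
      by (rule vector_derivative_unique_within[OF nb])
    \<comment> \<open>Right multiplication by \<open>N t\<close> cancels \<open>M t\<close> and
      isolates \<open>N' t\<close>.\<close>
    then have "(N t ** M' t + N' t ** M t) ** N t = 0"
      by simp
    then have z: "N' t + (N t ** M' t) ** N t = 0"
      using MN[OF t] by (simp add: matrix_add_rdistrib add.commute flip: matrix_mul_assoc)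
    have "((\<lambda>u. l u v* N u) has_vector_derivative
        l t v* N' t + (l t v* (N t ** M' t)) v* N t) (at t within S)"
      by (rule bounded_bilinear.has_vector_derivative[OF bounded_bilinear_vector_matrix_mult
            l[OF t] N[OF t]])
    also have "l t v* N' t + (l t v* (N t ** M' t)) v* N t = l t v* (N' t + (N t ** M' t) ** N t)"
      by (simp add: vector_matrix_mul_assoc bounded_bilinear.add_right
          [OF bounded_bilinear_vector_matrix_mult])
    finally show ?thesis
      by (simp add: z has_vector_derivative_def)
  qed
  from has_derivative_zero_constant[OF conv this] show ?thesis
    using \<open>a \<in> S\<close> \<open>b \<in> S\<close> by metis
qed simp

section \<open>Momentum along extremals\<close>

text \<open>The metric makes the three controlled frame fields orthonormal, so their momentum
  components are also the velocity components; the zeros are the directions outside the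
  distribution.\<close>

abbreviation linear_velocity :: "real^(3+3) \<Rightarrow> real^3" where
  "linear_velocity p \<equiv> vector [0, 0, p $ Inl 3]"

abbreviation angular_velocity :: "real^(3+3) \<Rightarrow> real^3" where
  "angular_velocity p \<equiv> vector [p $ Inr 1, p $ Inr 2, 0]"

lemma sr_extremal_horizontal:
  assumes "sr_extremal I \<gamma> l" "t \<in> I"
  shows "((\<lambda>u. fst (\<gamma> u)) has_vector_derivative snd (\<gamma> t) *v linear_velocity (l t))
      (at t within I)"
    and "((\<lambda>u. snd (\<gamma> u)) has_vector_derivative snd (\<gamma> t) ** hat (angular_velocity (l t)))
      (at t within I)"
proof -
  let ?D = "(l t $ Inl 3) *\<^sub>R left_frame (Inl 3) (\<gamma> t) + (l t $ Inr 1) *\<^sub>R left_frame (Inr 1) (\<gamma> t)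
      + (l t $ Inr 2) *\<^sub>R left_frame (Inr 2) (\<gamma> t)"
  have D: "(\<gamma> has_vector_derivative ?D) (at t within I)"
    using assms by (simp add: sr_extremal_def Let_def)
  have v: "linear_velocity (l t) = (l t $ Inl 3) *\<^sub>R axis 3 1"
    by (simp add: vec_eq_iff forall_3 axis_def)
  have w: "angular_velocity (l t) = (l t $ Inr 1) *\<^sub>R axis 1 1 + (l t $ Inr 2) *\<^sub>R axis 2 1"
    by (simp add: vec_eq_iff forall_3 axis_def)
  have "fst ?D = snd (\<gamma> t) *v linear_velocity (l t)"
    unfolding v by (simp add: left_frame_def case_prod_beta matrix_vector_mult_scaleR)
  with bounded_linear.has_vector_derivative[OF bounded_linear_fst D]
  show "((\<lambda>u. fst (\<gamma> u)) has_vector_derivative snd (\<gamma> t) *v linear_velocity (l t))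
      (at t within I)" by simp
  have "snd ?D = snd (\<gamma> t) ** hat (angular_velocity (l t))"
    unfolding w
    by (simp add: left_frame_def case_prod_beta linear_add[OF linear_hat]
        linear_scale[OF linear_hat] matrix_add_ldistrib
        bounded_bilinear.scaleR_right[OF bounded_bilinear_matrix_mult])
  with bounded_linear.has_vector_derivative[OF bounded_linear_snd D]
  show "((\<lambda>u. snd (\<gamma> u)) has_vector_derivative snd (\<gamma> t) ** hat (angular_velocity (l t)))
      (at t within I)" by simp
qed

lemma vec3_has_vector_derivative:
  fixes f :: "real \<Rightarrow> real^3"
  assumes "\<And>i. ((\<lambda>u. f u $ i) has_real_derivative f' $ i) (at t within S)"
  shows "(f has_vector_derivative f') (at t within S)"
  unfolding has_vector_derivative_def
  by (subst has_derivative_componentwise_within)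
    (use assms in \<open>auto simp: Basis_vec_def inner_axis has_field_derivative_def mult_commute_abs\<close>)

text \<open>The vertical equations in coadjoint form: the halves p and q of the momentum satisfy p'
  = p \<times> w and q' = p \<times> v + q \<times> w, and \<open>vector_mult_hat\<close> reads both
  as one row action.\<close>

lemma sr_extremal_vertical:
  assumes "sr_extremal I \<gamma> l" "t \<in> I"
  defines "w \<equiv> angular_velocity (l t)" and "v \<equiv> linear_velocity (l t)"
  shows "(l has_vector_derivative l t v* block_matrix (hat w) (hat v) 0 (hat w)) (at t within I)"
proof -
  let ?p = "\<lambda>u. \<chi> i. l u $ Inl i" and ?q = "\<lambda>u. \<chi> i. l u $ Inr i"
  have l_eq: "l = (\<lambda>u. block_vector (?p u) (?q u))"
    by (auto simp: fun_eq_iff block_vector_def vec_eq_iff split: sum.splits)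
  have "(?p has_vector_derivative cross3 (?p t) w) (at t within I)"
  proof (rule vec3_has_vector_derivative)
    fix i :: 3
    show "((\<lambda>u. ?p u $ i) has_real_derivative cross3 (?p t) w $ i) (at t within I)"
      using assms exhaust_3[of i]
      by (auto simp: sr_extremal_def Let_def cross3_def mult.commute)
  qed
  moreover have "(?q has_vector_derivative cross3 (?p t) v + cross3 (?q t) w) (at t within I)"
  proof (rule vec3_has_vector_derivative)
    fix i :: 3
    show "((\<lambda>u. ?q u $ i) has_real_derivative (cross3 (?p t) v + cross3 (?q t) w) $ i)
        (at t within I)"
      \<comment> \<open>In the third component p \<times> v vanishes and the two terms of q \<times>
        w cancel, in agreement with the constancy of the sixth momentum component.\<close>
      using assms exhaust_3[of i]
      by (auto simp: sr_extremal_def Let_def cross3_def mult.commute)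
  qed
  ultimately have "((\<lambda>u. (?p u, ?q u)) has_vector_derivative
      (cross3 (?p t) w, cross3 (?p t) v + cross3 (?q t) w)) (at t within I)"
    by (rule has_vector_derivative_Pair)
  from has_vector_derivative_linear[OF linear_block_vector this]
  have "(l has_vector_derivative
      block_vector (cross3 (?p t) w) (cross3 (?p t) v + cross3 (?q t) w)) (at t within I)"
    by (subst l_eq) simp
  also have "block_vector (cross3 (?p t) w) (cross3 (?p t) v + cross3 (?q t) w)
      = block_vector (?p t) (?q t) v* block_matrix (hat w) (hat v) 0 (hat w)"
    by (simp add: block_vector_matrix_mult vector_mult_hat)
  also have "block_vector (?p t) (?q t) = l t"
    by (subst l_eq) simp
  finally show ?thesis .
qed

text \<open>In the upper right block the product rule leaves hat(R v) R, which
  \<open>hat_rotation\<close> rewrites as R hat(v); then m factors out on the left.\<close>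

lemma sr_extremal_se3_rep:
  assumes ext: "sr_extremal I \<gamma> l" and t: "t \<in> I"
  defines "w \<equiv> angular_velocity (l t)" and "v \<equiv> linear_velocity (l t)"
  shows "((\<lambda>u. se3_rep (\<gamma> u)) has_vector_derivative
      se3_rep (\<gamma> t) ** block_matrix (hat w) (hat v) 0 (hat w)) (at t within I)"
proof -
  have "rotation_matrix (snd (\<gamma> t))"
    using ext t by (auto simp: sr_extremal_def Let_def SE3_def case_prod_beta)
  then have "block_matrix (snd (\<gamma> t) ** hat w)
      (hat (fst (\<gamma> t)) ** (snd (\<gamma> t) ** hat w) + hat (snd (\<gamma> t) *v v) ** snd (\<gamma> t))
      0 (snd (\<gamma> t) ** hat w) = se3_rep (\<gamma> t) ** block_matrix (hat w) (hat v) 0 (hat w)"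
    by (simp add: se3_rep_def case_prod_beta block_matrix_mult hat_rotation matrix_mul_assoc
        add.commute)
  with se3_rep_has_vector_derivative[OF sr_extremal_horizontal[OF ext t]]
  show ?thesis by (simp add: w_def v_def)
qed

text \<open>Left multiplication by m(\<gamma>^{-1}) strips m(\<gamma>) off its own derivative and
  leaves exactly the matrix that drives the vertical equations.\<close>

lemma sr_extremal_momentum:
  assumes ext: "sr_extremal I \<gamma> l" and t: "t \<in> I"
  obtains dm where "((\<lambda>u. se3_rep (\<gamma> u)) has_vector_derivative dm) (at t within I)"
    "(l has_vector_derivative (l t v* (se3_rep (inv\<^bsub>SE3\<^esub> (\<gamma> t)) ** dm))) (at t within I)"
proof
  let ?L = "block_matrix (hat (angular_velocity (l t))) (hat (linear_velocity (l t))) 0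
    (hat (angular_velocity (l t)))"
  show "((\<lambda>u. se3_rep (\<gamma> u)) has_vector_derivative se3_rep (\<gamma> t) ** ?L) (at t within I)"
    by (rule sr_extremal_se3_rep[OF ext t])
  have "\<gamma> t \<in> carrier SE3"
    using ext t by (simp add: sr_extremal_def Let_def)
  then have "se3_rep (inv\<^bsub>SE3\<^esub> (\<gamma> t)) ** (se3_rep (\<gamma> t) ** ?L) = ?L"
    by (simp add: matrix_mul_assoc se3_rep_inv)
  then show "(l has_vector_derivative
      (l t v* (se3_rep (inv\<^bsub>SE3\<^esub> (\<gamma> t)) ** (se3_rep (\<gamma> t) ** ?L)))) (at t within I)"
    using sr_extremal_vertical[OF ext t] by simp
qed

text \<open>Differentiability is read off the explicit inverse (- R^T x, R^T). Existence suffices,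
  since \<open>transport_constant\<close> recovers the value of the derivative.\<close>

lemma sr_extremal_se3_rep_inv:
  assumes ext: "sr_extremal I \<gamma> l" and t: "t \<in> I"
  obtains dn where "((\<lambda>u. se3_rep (inv\<^bsub>SE3\<^esub> (\<gamma> u))) has_vector_derivative dn) (at t within I)"
proof -
  have lin: "linear (transpose :: real^3^3 \<Rightarrow> real^3^3)"
    by (rule linearI) (simp_all add: transpose_def vec_eq_iff)
  note D = sr_extremal_horizontal[OF ext t]
  note T = has_vector_derivative_linear[OF lin D(2)]
  note X = has_vector_derivative_minus[OF
      bounded_bilinear.has_vector_derivative[OF bounded_bilinear_matrix_vector_mult T D(1)]]
  have eq: "se3_rep (inv\<^bsub>SE3\<^esub> (\<gamma> u)) =
      se3_rep (- (transpose (snd (\<gamma> u)) *v fst (\<gamma> u)), transpose (snd (\<gamma> u)))" if "u \<in> I" for u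
    using ext that inv_SE3[of "fst (\<gamma> u)" "snd (\<gamma> u)"] by (simp add: sr_extremal_def Let_def)
  show thesis
    by (rule that, rule has_vector_derivative_transform[OF t eq
          se3_rep_has_vector_derivative[OF X T]])
qed

lemma sr_extremal_momentum_constant:
  assumes ext: "sr_extremal I \<gamma> l" and "a \<in> I" "b \<in> I"
  shows "l a v* matrix_inv (se3_rep (\<gamma> a)) = l b v* matrix_inv (se3_rep (\<gamma> b))"
proof -
  have carrier: "\<gamma> t \<in> carrier SE3" if "t \<in> I" for t
    using ext that by (simp add: sr_extremal_def Let_def)
  have "\<forall>t\<in>I. \<exists>dm. ((\<lambda>u. se3_rep (\<gamma> u)) has_vector_derivative dm) (at t within I) \<and>
      (l has_vector_derivative (l t v* (se3_rep (inv\<^bsub>SE3\<^esub> (\<gamma> t)) ** dm))) (at t within I)"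
    using sr_extremal_momentum[OF ext] by blast
  \<comment> \<open>One choice function serves both statements, so the same matrix appears in the
    derivative of m(\<gamma>) and in that of the momentum.\<close>
  from bchoice[OF this] obtain M' where M': "\<And>t. t \<in> I \<Longrightarrow>
      ((\<lambda>u. se3_rep (\<gamma> u)) has_vector_derivative M' t) (at t within I)"
    "\<And>t. t \<in> I \<Longrightarrow>
      (l has_vector_derivative (l t v* (se3_rep (inv\<^bsub>SE3\<^esub> (\<gamma> t)) ** M' t))) (at t within I)"
    by blast
  have "\<forall>t\<in>I. \<exists>dn.
      ((\<lambda>u. se3_rep (inv\<^bsub>SE3\<^esub> (\<gamma> u))) has_vector_derivative dn) (at t within I)"
    using sr_extremal_se3_rep_inv[OF ext] by blast
  from bchoice[OF this] obtain N' where N': "\<And>t. t \<in> I \<Longrightarrow>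
      ((\<lambda>u. se3_rep (inv\<^bsub>SE3\<^esub> (\<gamma> u))) has_vector_derivative N' t) (at t within I)"
    by blast
  have "is_interval I"
    using ext by (simp add: sr_extremal_def)
  from transport_constant[OF this se3_rep_inv[OF carrier] M'(1) N' M'(2) assms(2,3)]
  have "l a v* se3_rep (inv\<^bsub>SE3\<^esub> (\<gamma> a)) = l b v* se3_rep (inv\<^bsub>SE3\<^esub> (\<gamma> b))" .
  then show ?thesis
    using assms(2,3) by (simp add: matrix_inv_se3_rep carrier)
qed

section \<open>Reparametrization by spatial arclength\<close>

text \<open>The arclength has derivative \<open>l u $ Inl 3\<close>, which is positive strictly
  between any two times of the set, so it is strictly increasing there.\<close>

lemma inj_on_spatial_arclength:
  assumes ext: "sr_extremal I \<gamma> l"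
  shows "inj_on (spatial_arclength l) (times_to_first_cusp I l)"
proof (rule linorder_inj_onI')
  fix a b assume a: "a \<in> times_to_first_cusp I l" and b: "b \<in> times_to_first_cusp I l"
    and "a < b"
  have pos: "0 < l u $ Inl 3" if "a < u" "u < b" for u
    using a b that by (auto simp: times_to_first_cusp_def)
  have "0 \<le> a" and I: "0 \<in> I" "b \<in> I" "is_interval I"
    using a b ext by (auto simp: times_to_first_cusp_def sr_extremal_def)
  have sub: "{0..b} \<subseteq> I"
    using mem_is_interval_1_I[OF I(3,1,2)] by auto
  have "continuous_on I (\<lambda>u. l u $ Inl 3)"
    using ext
    by (intro DERIV_continuous_on[where D = "\<lambda>u. l u $ Inl 1 * l u $ Inr 2 - l u $ Inl 2 * l u $ Inr 1"])
      (simp add: sr_extremal_def Let_def)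
  then have cont: "continuous_on {0..b} (\<lambda>u. l u $ Inl 3)"
    using sub continuous_on_subset by blast
  have D: "(spatial_arclength l has_real_derivative l u $ Inl 3) (at u within {0..b})"
    if "u \<in> {0..b}" for u
    unfolding spatial_arclength_def
    using integral_has_vector_derivative[OF cont that]
    by (simp add: has_real_derivative_iff_has_vector_derivative)
  have "spatial_arclength l a < spatial_arclength l b"
  \<comment> \<open>The version with positivity on the open interval is used because the derivative
    may vanish at time 0 or at the cusp.\<close>
  proof (rule DERIV_pos_imp_increasing_open[OF \<open>a < b\<close>])
    fix u assume u: "a < u" "u < b"
    then have "at u within {0..b} = at u"
      using \<open>0 \<le> a\<close> by (intro at_within_interior) auto
    then show "\<exists>y. DERIV (spatial_arclength l) u :> y \<and> 0 < y"
      using D[of u] pos[OF u] u \<open>0 \<le> a\<close> by auto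
  next
    show "continuous_on {a..b} (spatial_arclength l)"
      by (rule continuous_on_subset[OF DERIV_continuous_on[OF D]]) (use \<open>0 \<le> a\<close> in auto)
  qed
  then show "spatial_arclength l a \<noteq> spatial_arclength l b" by simp
qed

theorem theorem4:
  fixes I :: "real set" and \<gamma> :: "real \<Rightarrow> (real^3) \<times> (real^3^3)" and l :: "real \<Rightarrow> real^(3+3)"
  assumes "sr_extremal I \<gamma> l"
  shows "group_hom SE3 Aut_R6 se3_rep \<and>
    (\<forall>t\<in>I. \<exists>dm. ((\<lambda>u. se3_rep (\<gamma> u)) has_vector_derivative dm) (at t within I) \<and>
       (l has_vector_derivative (l t v* (se3_rep (inv\<^bsub>SE3\<^esub> (\<gamma> t)) ** dm))) (at t within I)) \<and>
    (\<gamma> 0 = \<one>\<^bsub>SE3\<^esub> \<longrightarrow>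
      (let \<gamma>s = by_spatial_arclength I l \<gamma>; ls = by_spatial_arclength I l l
       in \<forall>s\<in>spatial_range I l.
            ls s v* matrix_inv (se3_rep (\<gamma>s s)) = ls 0 v* matrix_inv (se3_rep (\<gamma>s 0)) \<and>
            ls 0 v* matrix_inv (se3_rep (\<gamma>s 0)) = ls 0))"
proof (intro conjI ballI impI)
  show "group_hom SE3 Aut_R6 se3_rep" by (rule group_hom_se3_rep)
next
  fix t assume "t \<in> I"
  then show "\<exists>dm. ((\<lambda>u. se3_rep (\<gamma> u)) has_vector_derivative dm) (at t within I) \<and>
      (l has_vector_derivative (l t v* (se3_rep (inv\<^bsub>SE3\<^esub> (\<gamma> t)) ** dm))) (at t within I)"
    using sr_extremal_momentum[OF assms] by metis
next
  assume one: "\<gamma> 0 = \<one>\<^bsub>SE3\<^esub>"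
  let ?T = "times_to_first_cusp I l" and ?\<sigma> = "spatial_arclength l"
  have inv: "the_inv_into ?T ?\<sigma> (?\<sigma> t) = t" if "t \<in> ?T" for t
    using that by (rule the_inv_into_f_f[OF inj_on_spatial_arclength[OF assms]])
  have "0 \<in> I" using assms by (simp add: sr_extremal_def)
  \<comment> \<open>No \<open>u\<close> satisfies 0 < u < 0, so the positivity condition is vacuous
    at time 0.\<close>
  then have "0 \<in> ?T" by (simp add: times_to_first_cusp_def)
  \<comment> \<open>The integral over \<open>{0..0}\<close> is zero, so s = 0 corresponds to time 0.
    The function \<open>f\<close> is arbitrary because both the curve and the momentum are evaluated
    there.\<close>
  from inv[OF this] have start: "by_spatial_arclength I l f 0 = f 0" for f :: "real \<Rightarrow> 'a"
    by (simp add: by_spatial_arclength_def spatial_arclength_def)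
  have "l 0 v* matrix_inv (se3_rep (\<gamma> 0)) = l 0"
    using matrix_inv_se3_rep[of "\<one>\<^bsub>SE3\<^esub>"] group.is_monoid[OF group_SE3]
      monoid.inv_one[OF group.is_monoid[OF group_SE3]]
    by (simp add: one se3_rep_one)
  moreover have "by_spatial_arclength I l l s v* matrix_inv (se3_rep (by_spatial_arclength I l \<gamma> s)) =
      l 0 v* matrix_inv (se3_rep (\<gamma> 0))" if "s \<in> spatial_range I l" for s
  proof -
    from that obtain t where t: "t \<in> ?T" and s: "s = ?\<sigma> t"
      by (auto simp: spatial_range_def)
    then have "t \<in> I" by (simp add: times_to_first_cusp_def)
    with sr_extremal_momentum_constant[OF assms _ \<open>0 \<in> I\<close>] show ?thesis
      by (simp add: by_spatial_arclength_def s inv[OF t])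
  qed
  ultimately show "let \<gamma>s = by_spatial_arclength I l \<gamma>; ls = by_spatial_arclength I l l
       in \<forall>s\<in>spatial_range I l.
            ls s v* matrix_inv (se3_rep (\<gamma>s s)) = ls 0 v* matrix_inv (se3_rep (\<gamma>s 0)) \<and>
            ls 0 v* matrix_inv (se3_rep (\<gamma>s 0)) = ls 0"
    by (simp add: Let_def start)
qed

end
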